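(* Let $S \subset \mathbb{C}^2$ be a finite set of points, not all lying on one line. Suppose that $S$ is contained in the union of $m$ distinct lines $\ell_1,\ldots,\ell_m$ of $\mathbb{C}^2$ which all pass through a common point $p$. If for some $j$ the line $\ell_j$ contains more than $m-2$ points of $S \setminus \{p\}$, then $S$ admits an ordinary line, i.e. there is a line in $\mathbb{C}^2$ containing exactly two points of $S$.
   Context: An ordinary line of a finite point set $S$ is a line containing exactly two points of $S$. *)

theory Defs
  imports "HOL-Analysis.Analysis"
begin

text \<open>The library's \<^const>\<open>affine\<close> is about real scalars; here lines are affine lines over
  the complex numbers.\<close>

definition complex_line :: "(complex ^ 2) set \<Rightarrow> bool" where
  "complex_line L \<longleftrightarrow> (\<exists>a d. d \<noteq> 0 \<and> L = {a + t *s d | t. True})"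

definition ordinary_line :: "(complex ^ 2) set \<Rightarrow> (complex ^ 2) set \<Rightarrow> bool" where
  "ordinary_line S L \<longleftrightarrow> complex_line L \<and> card (S \<inter> L) = 2"

end

theory Submission
  imports Defs
begin

text \<open>
  Put \<open>p\<close> at the origin and let \<open>l\<^sub>j\<close> be the line \<open>X = 0\<close>. A point \<open>(X, Y)\<close> off \<open>l\<^sub>j\<close> is described by
  \<open>b = Y / X\<close>, which names the line through \<open>p\<close> containing it, and \<open>c = 1 / X\<close>; a point \<open>(0, \<sigma>)\<close> of \<open>l\<^sub>j\<close>
  by \<open>z = 1 / \<sigma>\<close>. Two points are collinear with \<open>(0, \<sigma>)\<close> iff their values \<open>c - z b\<close> agree. Without
  ordinary lines, every value at every \<open>z\<close> is therefore attained for at least two different \<open>b\<close>. Keep for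
  each \<open>b\<close> only the \<open>c\<close> that is extreme with respect to a generic real functional: then at each \<open>z\<close> the
  upper envelope of the real parts of \<open>g\<^sub>b(z) = c\<^sub>b - b z\<close> is attained by at least two functions, and
  these agree as complex numbers. It remains to see that \<open>n\<close> functions allow at most \<open>n - 1\<close> such \<open>z\<close>.

  The envelope divides the plane into convex cells. Along the edge between cells \<open>i\<close> (left) and \<open>k\<close>
  (right) the number \<open>g\<^sub>i - g\<^sub>k\<close> is purely imaginary and its imaginary part strictly decreases upwards.
  Sweep a horizontal line upwards and count the edges it crosses on which this imaginary part is
  positive. Each \<open>z\<close> in question destroys a positive edge, and a positive edge is created only when a
  new cell appears; at the bottom there are at most as many as cells present, minus one.
\<close>

section \<open>Upper hulls of finite planar point sets\<close>

text \<open>For \<open>x k < x i\<close> this is \<open>x i - x k\<close> times the height of the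
  line through \<open>k\<close> and \<open>i\<close> above point \<open>j\<close>; it is nonnegative
  iff \<open>j\<close> lies on or below that line.\<close>

definition turn :: "('i \<Rightarrow> real) \<Rightarrow> ('i \<Rightarrow> real) \<Rightarrow> 'i \<Rightarrow> 'i \<Rightarrow> 'i \<Rightarrow> real" where
  "turn x y i k j = (x j - x i) * (y i - y k) - (y j - y i) * (x i - x k)"

text \<open>Edges of the upper convex hull of the points \<open>(x j, y j)\<close>; points in the interior of an edge
  are not treated as vertices.\<close>

definition hull_edges :: "('i \<Rightarrow> real) \<Rightarrow> ('i \<Rightarrow> real) \<Rightarrow> 'i set \<Rightarrow> ('i \<times> 'i) set" where
  "hull_edges x y M = {(i, k). i \<in> M \<and> k \<in> M \<and> x k < x i \<and>
     (\<forall>j\<in>M. turn x y i k j \<ge> 0 \<and> (turn x y i k j = 0 \<longrightarrow> x k \<le> x j \<and> x j \<le> x i))}"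

lemma hull_edgesD:
  assumes "(i, k) \<in> hull_edges x y M"
  shows "i \<in> M" "k \<in> M" "x k < x i"
    and "\<And>j. j \<in> M \<Longrightarrow> turn x y i k j \<ge> 0"
    and "\<And>j. j \<in> M \<Longrightarrow> turn x y i k j = 0 \<Longrightarrow> x k \<le> x j \<and> x j \<le> x i"
  using assms by (auto simp: hull_edges_def)

lemma turn_uminus: "turn x (\<lambda>j. - y j) i k j = - turn x y i k j"
  by (simp add: turn_def algebra_simps)

lemma turn_right: "turn x y i k k = 0"
  by (simp add: turn_def algebra_simps)

lemma turn_swap: "turn x y i' k i = - turn x y i k i'"
  by (simp add: turn_def algebra_simps)

text \<open>By \<open>turn_swap\<close> the two turns are opposite, so both vanish; the maximality
  clause for collinear points then makes the right ends equal.\<close>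

lemma hull_edges_inj_right:
  assumes "inj_on x M" "(i, k) \<in> hull_edges x y M" "(i', k) \<in> hull_edges x y M"
  shows "i = i'"
proof -
  note h = hull_edgesD[OF assms(2)] and h' = hull_edgesD[OF assms(3)]
  have "turn x y i k i' = 0"
    using h(4)[OF h'(1)] h'(4)[OF h(1)] turn_swap[of x y i' k i] by simp
  moreover from this have "turn x y i' k i = 0"
    using turn_swap[of x y i' k i] by simp
  ultimately have "x i = x i'" using h(5)[OF h'(1)] h'(5)[OF h(1)] by simp
  then show ?thesis using assms(1) h(1) h'(1) by (auto dest: inj_onD)
qed

text \<open>Gift wrapping: from a hull vertex \<open>i\<close>, given as the rightmost point or the
  left end of an edge, the next edge goes left with least slope, to the leftmost candidate.\<close>

lemma hull_edges_next:
  assumes fin: "finite M" and i: "i \<in> M"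
    and start: "(\<forall>j\<in>M. x j \<le> x i) \<or> (\<exists>h. (h, i) \<in> hull_edges x y M)"
    and inj: "inj_on x M" and l: "l \<in> M" "x l < x i"
  shows "\<exists>k. (i, k) \<in> hull_edges x y M"
proof -
  let ?A = "{j \<in> M. x j < x i}"
  define s where "s j = (y i - y j) / (x i - x j)" for j
  have A: "finite ?A" "?A \<noteq> {}" using fin l by auto
  define \<mu> where "\<mu> = Min (s ` ?A)"
  let ?B = "{j \<in> ?A. s j = \<mu>}"
  have "\<mu> \<in> s ` ?A" unfolding \<mu>_def using A by (intro Min_in) auto
  then have B: "finite ?B" "?B \<noteq> {}" using finite_subset[OF _ A(1), of ?B] by auto
  obtain k where k: "k \<in> ?B" "\<And>j. j \<in> ?B \<Longrightarrow> x k \<le> x j"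
    using arg_min_if_finite[OF B, of x] by (metis (mono_tags, lifting) not_le)
  have kM: "k \<in> M" "x k < x i" "s k = \<mu>" using k by auto
  have smin: "s k \<le> s j" if "j \<in> ?A" for j
    unfolding kM \<mu>_def using A that by (intro Min_le) auto
  have turn_s: "turn x y i k j = (s j - s k) * ((x i - x j) * (x i - x k))" if "j \<in> ?A" for j
  proof -
    have "s j * (x i - x j) = y i - y j" "s k * (x i - x k) = y i - y k"
      using that kM by (auto simp: s_def)
    then show ?thesis unfolding turn_def by algebra
  qed
  have "turn x y i k j \<ge> 0 \<and> (turn x y i k j = 0 \<longrightarrow> x k \<le> x j \<and> x j \<le> x i)" if j: "j \<in> M" for j
  proof (cases "x j < x i")
    case True
    then have jA: "j \<in> ?A" using j by auto
    have pos: "(x i - x j) * (x i - x k) > 0" using True kM by simp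
    have "turn x y i k j \<ge> 0"
      unfolding turn_s[OF jA] using smin[OF jA] pos by (simp add: mult_nonneg_nonneg less_imp_le)
    moreover have "x k \<le> x j" if "turn x y i k j = 0"
    proof -
      have "s j = s k" using that pos unfolding turn_s[OF jA] by auto
      then show ?thesis using k(2) jA kM by auto
    qed
    ultimately show ?thesis using True by auto
  next
    case False
    show ?thesis
    proof (cases "j = i")
      case True
      then show ?thesis using kM by (simp add: turn_def)
    next
      case False
      then have xj: "x j > x i" using \<open>\<not> x j < x i\<close> inj i j by (metis inj_onD linorder_neqE_linordered_idom)
      then obtain h where h: "(h, i) \<in> hull_edges x y M" using start j by (meson not_le)
      note hd = hull_edgesD[OF h]
      have tk: "turn x y h i k > 0" using hd(4,5)[OF kM(1)] kM(2) by force
      have tj: "turn x y h i j \<ge> 0" using hd(4)[OF j] .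
      \<comment> \<open>The line of the edge \<open>(h, i)\<close> has \<open>k\<close> strictly
        below it and \<open>j\<close> not above it; the identity turns this into \<open>j\<close>
        lying strictly below the line through \<open>k\<close> and \<open>i\<close>.\<close>
      have "turn x y i k j * (x h - x i) = (x j - x i) * turn x y h i k + (x i - x k) * turn x y h i j"
        unfolding turn_def by algebra
      also have "\<dots> > 0" using xj tk tj kM(2) by (intro add_pos_nonneg mult_pos_pos mult_nonneg_nonneg) auto
      finally have "turn x y i k j > 0" using hd(3) by (simp add: zero_less_mult_iff)
      then show ?thesis by simp
    qed
  qed
  then have "(i, k) \<in> hull_edges x y M" unfolding hull_edges_def using i kM by blast
  then show ?thesis ..
qed

lemma hull_path_decreasing:
  assumes fin: "finite M" and inj: "inj_on x M" and l: "l \<in> M" "\<forall>j\<in>M. x l \<le> x j"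
    and dec: "\<And>i k. (i, k) \<in> hull_edges x y M \<Longrightarrow> u k < (u i :: real)"
    and i: "i \<in> M" "(\<forall>j\<in>M. x j \<le> x i) \<or> (\<exists>h. (h, i) \<in> hull_edges x y M)" "i \<noteq> l"
  shows "u l < u i"
  using i
proof (induction "card {j \<in> M. x j < x i}" arbitrary: i rule: less_induct)
  case less
  have "x l \<noteq> x i" using less.prems l inj by (auto dest: inj_onD)
  then have "x l < x i" using l less.prems(1) by (simp add: less_le)
  then obtain k where k: "(i, k) \<in> hull_edges x y M"
    using hull_edges_next[OF fin less.prems(1,2) inj l(1)] by blast
  note kd = hull_edgesD[OF k]
  show ?case
  proof (cases "k = l")
    case True
    then show ?thesis using dec[OF k] by simp
  next
    case False
    have "{j \<in> M. x j < x k} \<subset> {j \<in> M. x j < x i}" using kd by auto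
    then have "card {j \<in> M. x j < x k} < card {j \<in> M. x j < x i}"
      using fin by (intro psubset_card_mono) auto
    then have "u l < u k" using less.hyps kd(2) k False by blast
    then show ?thesis using dec[OF k] by simp
  qed
qed

text \<open>The change of the number of positive edges when the sweep line passes a point where the cells
  in \<open>M\<close> meet; \<open>B\<close> are the cells that appear there. If all upper edges descend strictly, then \<open>u\<close>
  descends from the first to the last vertex, so some lower edge descends as well.\<close>

lemma hull_edges_local_count:
  fixes x y u :: "'i \<Rightarrow> real"
  assumes fin: "finite M" and inj: "inj_on x M" and l: "l \<in> M" "\<forall>j\<in>M. x l \<le> x j"
  defines "B \<equiv> snd ` hull_edges x y M - {l}"
  assumes q: "q \<le> (1::nat)" "q = 1 \<Longrightarrow> card M \<ge> 2 \<and> (\<forall>i\<in>M. \<forall>j\<in>M. u i = u j)"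
  shows "card {(i, k) \<in> hull_edges x y M. u k < u i} + q
    \<le> card {(i, k) \<in> hull_edges x (\<lambda>j. - y j) M. u k \<le> u i} + card B"
    (is "card ?S + q \<le> card ?W + card B")
proof -
  let ?E = "hull_edges x y M" and ?E' = "hull_edges x (\<lambda>j. - y j) M"
  have finE: "finite (hull_edges x y' M)" for y'
    by (rule finite_subset[of _ "M \<times> M"]) (auto simp: hull_edges_def fin)
  have finW: "finite ?W" by (rule finite_subset[OF _ finE]) auto
  have finB: "finite B" unfolding B_def using finE by auto
  \<comment> \<open>An edge is determined by its left end, which lies in \<open>B\<close> or is
    \<open>l\<close>; hence at most one surplus edge.\<close>
  have "inj_on snd ?E"
    by (rule inj_onI) (auto dest: hull_edges_inj_right[OF inj])
  then have cE: "card ?E = card (snd ` ?E)" by (simp add: card_image)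
  also have "\<dots> \<le> card (insert l B)" using finB by (intro card_mono) (auto simp: B_def)
  also have "\<dots> \<le> Suc (card B)" by (rule card_insert_le_m1) auto
  finally have EB: "card ?E \<le> Suc (card B)" .
  have "\<exists>f\<in>M. \<forall>j\<in>M. x j \<le> x f"
    using Max_in[of "x ` M"] Max_ge[of "x ` M"] fin l(1) by fastforce
  then obtain f where f: "f \<in> M" "\<forall>j\<in>M. x j \<le> x f" by blast
  show ?thesis
  proof (cases "q = 1")
    case True
    \<comment> \<open>Equal values of \<open>u\<close> make no upper edge strict, while every lower
      edge counts: this asymmetry pays for \<open>q\<close>.\<close>
    have "u k = u i" if "(i, k) \<in> ?E" for i k
      using q(2)[OF True] hull_edgesD(1,2)[OF that] by blast
    then have S: "?S = {}" by force
    have "f \<noteq> l"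
    proof
      assume "f = l"
      then have "M \<subseteq> {f}" using f l inj by (force dest: inj_onD)
      then show False using q(2)[OF True] card_mono[of "{f}" M] by auto
    qed
    then have "x l < x f" using f l inj by (metis inj_onD less_le)
    then obtain k where k: "(f, k) \<in> ?E'"
      using hull_edges_next[OF fin f(1) disjI1[OF f(2)] inj l(1)] by blast
    have "u k = u f" using q(2)[OF True] hull_edgesD(1,2)[OF k] by blast
    then have "(f, k) \<in> ?W" using k by simp
    then have "card ?W > 0" using finW by (auto simp: card_gt_0_iff)
    then show ?thesis unfolding S True by simp
  next
    case False
    then have q0: "q = 0" using q by simp
    show ?thesis
    proof (cases "?S = ?E \<and> ?E \<noteq> {}")
      case True
      then obtain i k where ik: "(i, k) \<in> ?E" by auto
      have "f \<noteq> l" using hull_edgesD(1-3)[OF ik] f l by force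
      have "u l < u f"
        by (rule hull_path_decreasing[OF fin inj l _ f(1) _ \<open>f \<noteq> l\<close>]) (use True f in auto)
      have "?W \<noteq> {}"
      proof
        assume "?W = {}"
        then have "- u l < - u f"
          by (intro hull_path_decreasing[OF fin inj l _ f(1) _ \<open>f \<noteq> l\<close>, where y = "\<lambda>j. - y j"])
            (use f in \<open>force simp: not_le\<close>)+
        then show False using \<open>u l < u f\<close> by simp
      qed
      then have "card ?W > 0" using finW by (auto simp: card_gt_0_iff)
      then show ?thesis using EB True q0 by simp
    next
      case False
      then have "card ?S \<le> card B"
      proof (cases "?E = {}")
        case E: False
        then have "?S \<subset> ?E" using False by auto
        then have "card ?S < card ?E" using finE by (intro psubset_card_mono) auto
        then show ?thesis using EB by simp
      qed auto
      then show ?thesis using q0 by simp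
    qed
  qed
qed


lemma sum_card_swap:
  assumes "finite A" "finite B"
  shows "(\<Sum>a\<in>A. card {b \<in> B. R a b}) = (\<Sum>b\<in>B. card {a \<in> A. R a b})"
proof -
  have "(\<Sum>a\<in>A. card {b \<in> B. R a b}) = (\<Sum>a\<in>A. \<Sum>b\<in>B. if R a b then 1 else 0)"
    using assms by (simp flip: sum.inter_filter)
  also have "\<dots> = (\<Sum>b\<in>B. \<Sum>a\<in>A. if R a b then 1 else 0)" by (rule sum.swap)
  also have "\<dots> = (\<Sum>b\<in>B. card {a \<in> A. R a b})"
    using assms by (simp flip: sum.inter_filter)
  finally show ?thesis .
qed

section \<open>The cells of an upper envelope\<close>

text \<open>Distinct real parts of the \<open>b j\<close> mean that no edge of the subdivision is
  horizontal.\<close>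

locale envelope =
  fixes I :: "'i set" and b c :: "'i \<Rightarrow> complex"
  assumes finite_I: "finite I" and inj_Re: "inj_on (\<lambda>j. Re (b j)) I"
begin

abbreviation "x j \<equiv> Re (b j)"
abbreviation "y j \<equiv> Im (b j)"

definition f :: "'i \<Rightarrow> complex \<Rightarrow> real" where "f j z = Re (c j - b j * z)"
definition u :: "'i \<Rightarrow> complex \<Rightarrow> real" where "u j z = Im (c j - b j * z)"
definition M :: "complex \<Rightarrow> 'i set" where "M z = {j \<in> I. \<forall>l\<in>I. f l z \<le> f j z}"
text \<open>The imaginary unit times \<open>cnj (b i - b k)\<close>: the direction of the line where
  \<open>f i\<close> and \<open>f k\<close> agree, pointing upwards if
  \<open>x k < x i\<close>.\<close>

definition dir :: "'i \<Rightarrow> 'i \<Rightarrow> complex" where "dir i k = Complex (y i - y k) (x i - x k)"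

text \<open>Near \<open>z\<close> only the functions in \<open>M z\<close> matter. The edges of the subdivision leaving \<open>z\<close> upwards
  correspond to the upper hull of their coefficients \<open>b j\<close>, those leaving downwards to the lower hull.\<close>

definition up :: "complex \<Rightarrow> ('i \<times> 'i) set" where "up z = hull_edges x y (M z)"
definition down :: "complex \<Rightarrow> ('i \<times> 'i) set" where "down z = hull_edges x (\<lambda>j. - y j) (M z)"

lemma M_subset: "M z \<subseteq> I" and finite_M: "finite (M z)"
  using finite_I by (auto simp: M_def)

lemma inj_M: "inj_on x (M z)"
  using inj_Re M_subset by (rule inj_on_subset)

lemma M_eq: "i \<in> M z \<Longrightarrow> j \<in> M z \<Longrightarrow> f i z = f j z"
  by (auto simp: M_def intro: antisym)

lemma M_le: "i \<in> M z \<Longrightarrow> j \<in> I \<Longrightarrow> f j z \<le> f i z"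
  by (auto simp: M_def)

lemma M_memI: "i \<in> M z \<Longrightarrow> j \<in> I \<Longrightarrow> f j z = f i z \<Longrightarrow> j \<in> M z"
  by (auto simp: M_def)

text \<open>Links cells to hulls: the sign of \<open>turn\<close> decides whether \<open>j\<close>
  gains on \<open>i\<close> along the edge between \<open>i\<close> and \<open>k\<close>.\<close>

lemma f_dir:
  "f j (z + of_real t * dir i k) - f i (z + of_real t * dir i k) = f j z - f i z - t * turn x y i k j"
  by (simp add: f_def dir_def turn_def algebra_simps)

text \<open>The factor is the squared modulus of \<open>b i - b k\<close>, whence the strict
  monotonicity on which the sweep relies.\<close>

lemma u_dir:
  "u i (z + of_real t * dir i k) - u k (z + of_real t * dir i k)
    = u i z - u k z - t * ((x i - x k)\<^sup>2 + (y i - y k)\<^sup>2)"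
  by (simp add: u_def dir_def power2_eq_square algebra_simps)

lemma tie_line:
  assumes "f i z = f k z" "f i z' = f k z'" "x k < x i"
  shows "z' = z + of_real ((Im z' - Im z) / (x i - x k)) * dir i k"
proof (rule complex_eqI)
  have "(Re z' - Re z) * (x i - x k) = (Im z' - Im z) * (y i - y k)"
    using assms(1,2) by (simp add: f_def algebra_simps)
  then show "Re z' = Re (z + of_real ((Im z' - Im z) / (x i - x k)) * dir i k)"
    using assms(3) by (simp add: dir_def field_simps)
qed (use assms(3) in \<open>simp add: dir_def\<close>)

lemma Im_dir: "Im (z + of_real t * dir i k) = Im z + t * (x i - x k)"
  by (simp add: dir_def)

section \<open>Edges followed downwards, and lowest points of cells\<close>

lemma downD:
  assumes "(i, k) \<in> down z"
  shows "i \<in> M z" "k \<in> M z" "x k < x i"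
    and "\<And>j. j \<in> M z \<Longrightarrow> turn x y i k j \<le> 0"
    and "\<And>j. j \<in> M z \<Longrightarrow> turn x y i k j = 0 \<Longrightarrow> x k \<le> x j \<and> x j \<le> x i"
  using hull_edgesD[OF assms[unfolded down_def]] by (auto simp: turn_uminus)

text \<open>A \<open>j\<close> tied with \<open>i\<close> at the lower point was not ahead at
  \<open>z\<close>, so its \<open>turn\<close> is nonnegative; if it is zero, \<open>j\<close> was
  tied at \<open>z\<close> already and maximality of the lower edge applies.\<close>

lemma in_up_below:
  assumes d: "(i, k) \<in> down z" and t: "t > 0"
    and M: "i \<in> M (z - of_real t * dir i k)"
  shows "(i, k) \<in> up (z - of_real t * dir i k)"
proof -
  let ?w = "z - of_real t * dir i k"
  note dd = downD[OF d]
  have diff: "f j ?w - f i ?w = f j z - f i z + t * turn x y i k j" for j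
    using f_dir[of j z "-t" i k] by simp
  have "f k ?w = f i ?w" using diff[of k] M_eq[OF dd(1,2)] by (simp add: turn_right)
  then have k: "k \<in> M ?w" using M_memI[OF M] dd(2) M_subset by blast
  have "turn x y i k j \<ge> 0 \<and> (turn x y i k j = 0 \<longrightarrow> x k \<le> x j \<and> x j \<le> x i)" if j: "j \<in> M ?w" for j
  proof -
    have e: "f j z - f i z + t * turn x y i k j = 0" using diff[of j] M_eq[OF j M] by simp
    moreover have "j \<in> I" using j M_subset by blast
    ultimately have "t * turn x y i k j \<ge> 0" using M_le[OF dd(1), of j] by linarith
    moreover have "j \<in> M z" if "turn x y i k j = 0"
      using M_memI[OF dd(1) \<open>j \<in> I\<close>] e that by simp
    ultimately show ?thesis using t dd(5)[of j] by (auto simp: zero_le_mult_iff)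
  qed
  then show ?thesis unfolding up_def hull_edges_def using M k dd(3) by blast
qed

text \<open>Edges that extend downwards to infinity.\<close>

definition bottomless :: "('i \<times> 'i) set" where
  "bottomless = {(i, k). (\<exists>z. (i, k) \<in> down z) \<and> (\<forall>j\<in>I. turn x y i k j \<le> 0)}"

definition vertices :: "complex set" where
  "vertices = {z. \<exists>i\<in>M z. \<exists>k\<in>M z. \<exists>j\<in>M z. turn x y i k j \<noteq> 0}"

text \<open>A tie of three functions with noncollinear coefficients is a regular linear system, so
  each triple yields at most one vertex.\<close>

lemma finite_vertices: "finite vertices"
proof -
  let ?T = "\<lambda>(i, k, j). if turn x y i k j \<noteq> 0 then {z. f i z = f k z \<and> f i z = f j z} else {}"
  have "vertices \<subseteq> (\<Union>t \<in> I \<times> I \<times> I. ?T t)"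
  proof
    fix z assume "z \<in> vertices"
    then obtain i k j where h: "i \<in> M z" "k \<in> M z" "j \<in> M z" "turn x y i k j \<noteq> 0"
      unfolding vertices_def by blast
    then have "(i, k, j) \<in> I \<times> I \<times> I" using M_subset by blast
    moreover have "z \<in> ?T (i, k, j)" using h M_eq[OF h(1,2)] M_eq[OF h(1,3)] by simp
    ultimately show "z \<in> (\<Union>t \<in> I \<times> I \<times> I. ?T t)" by blast
  qed
  moreover have "finite (?T t)" for t
  proof -
    obtain i k j where t: "t = (i, k, j)" by (cases t)
    have "z = z'" if "turn x y i k j \<noteq> 0" "f i z = f k z" "f i z = f j z" "f i z' = f k z'" "f i z' = f j z'"
      for z z'
    proof -
      define p q where "p = Re z - Re z'" and "q = Im z - Im z'"
      have 1: "(x i - x k) * p = (y i - y k) * q" "(x i - x j) * p = (y i - y j) * q"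
        using that by (auto simp: f_def p_def q_def algebra_simps)
      have "p * turn x y i k j = 0" "q * turn x y i k j = 0"
        using 1 unfolding turn_def by algebra+
      then have "p = 0" "q = 0" using that by auto
      then show ?thesis by (simp add: p_def q_def complex_eq_iff)
    qed
    then have "\<exists>z. ?T t \<subseteq> {z}" unfolding t by (auto; blast)
    then show ?thesis by (meson finite.emptyI finite_insert finite_subset)
  qed
  moreover from this have "finite (\<Union>t \<in> I \<times> I \<times> I. ?T t)"
    using finite_I by (intro finite_UN_I finite_cartesian_product)
  ultimately show ?thesis by (meson finite_subset)
qed

text \<open>All these points lie on the tie line of \<open>i\<close> and \<open>k\<close>. Each
  point of \<open>?D\<close> below the highest one, \<open>top\<close>, also belongs to
  \<open>?U\<close>, by \<open>in_up_below\<close> and \<open>u_dir\<close>. The unit for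
  \<open>top\<close> is supplied by the lower end of the edge or by
  \<open>bottomless\<close>.\<close>

lemma edge_count:
  assumes Ev: "finite Ev" "vertices \<subseteq> Ev"
  shows "card {z \<in> Ev. (i, k) \<in> down z \<and> u k z \<le> u i z}
    \<le> card {z \<in> Ev. (i, k) \<in> up z \<and> u k z < u i z} + of_bool ((i, k) \<in> bottomless)"
    (is "card ?D \<le> card ?U + _")
proof (cases "?D = {}")
  case False
  have finD: "finite ?D" and finU: "finite ?U" using Ev by auto
  obtain top where top: "top \<in> ?D" "\<And>z. z \<in> ?D \<Longrightarrow> Im z \<le> Im top"
    using arg_min_if_finite[OF finD False, of "\<lambda>z. - Im z"]
    by (metis (no_types, lifting) linorder_not_le neg_less_iff_less)
  have xik: "x k < x i" using top downD by blast
  have J: "u k w < u i w" if "z \<in> ?D" "t > 0" "w = z - of_real t * dir i k" for z t w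
  proof -
    have "u i w - u k w = u i z - u k z + t * ((x i - x k)\<^sup>2 + (y i - y k)\<^sup>2)"
      using u_dir[of i z "-t" k] that(3) by simp
    moreover have "t * ((x i - x k)\<^sup>2 + (y i - y k)\<^sup>2) > 0"
      using that xik by (intro mult_pos_pos add_pos_nonneg) auto
    ultimately show ?thesis using that by auto
  qed
  have line: "\<exists>t. z = z' - of_real t * dir i k \<and> (Im z < Im z' \<longrightarrow> t > 0)"
    if "z \<in> ?D" "z' \<in> ?D" for z z'
  proof -
    have tie: "f i z = f k z" "f i z' = f k z'" using that M_eq downD(1,2) by blast+
    let ?t = "(Im z' - Im z) / (x i - x k)"
    have "z = z' - of_real ?t * dir i k"
      using tie_line[OF tie xik] by (metis add_diff_cancel_right')
    moreover have "Im z < Im z' \<longrightarrow> ?t > 0" using xik by simp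
    ultimately show ?thesis by blast
  qed
  have below_up: "z \<in> ?U" if z: "z \<in> ?D" "z \<noteq> top" for z
  proof -
    obtain t where t: "z = top - of_real t * dir i k" "Im z < Im top \<longrightarrow> t > 0"
      using line[OF z(1) top(1)] by blast
    have "Im z \<noteq> Im top" using t(1) z(2) Im_dir[of top "-t" i k] xik by auto
    then have "Im z < Im top" using top(2)[OF z(1)] by linarith
    then have "t > 0" using t(2) by blast
    then have "(i, k) \<in> up z" "u k z < u i z"
      using in_up_below[of i k top t] t(1) top(1) z(1) downD(1) J[OF top(1)] by blast+
    then show ?thesis using z by simp
  qed
  have cD: "card ?D = Suc (card (?D - {top}))"
    using card_Suc_Diff1[OF finD top(1)] by simp
  show ?thesis
  proof (cases "(i, k) \<in> bottomless")
    case True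
    have "card (?D - {top}) \<le> card ?U" using below_up by (intro card_mono finU) blast
    then show ?thesis using True cD by simp
  next
    case False
    define P where "P = {j \<in> I. turn x y i k j > 0}"
    have P: "finite P" "P \<noteq> {}"
      using False finite_I top(1) by (auto simp: bottomless_def P_def not_le)
    have td: "(i, k) \<in> down top" using top(1) by simp
    note dd = downD[OF td]
    \<comment> \<open>How far below \<open>top\<close>, in multiples of \<open>dir i k\<close>,
      function \<open>j\<close> catches up with \<open>i\<close>; the minimum marks the lower end
      \<open>w\<close> of the edge.\<close>
    define \<tau> where "\<tau> j = (f i top - f j top) / turn x y i k j" for j
    obtain j where j: "j \<in> P" "\<And>l. l \<in> P \<Longrightarrow> \<tau> j \<le> \<tau> l"
      using arg_min_if_finite[OF P, of \<tau>] by (metis not_le)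
    have jP: "j \<in> I" "turn x y i k j > 0" using j by (auto simp: P_def)
    have "f j top \<noteq> f i top" using M_memI[OF dd(1) jP(1)] dd(4)[of j] jP by auto
    then have pos: "\<tau> j > 0" unfolding \<tau>_def using M_le[OF dd(1) jP(1)] jP by simp
    define w where "w = top - of_real (\<tau> j) * dir i k"
    have diff: "f l w - f i w = f l top - f i top + \<tau> j * turn x y i k l" for l
      using f_dir[of l top "- \<tau> j" i k] by (simp add: w_def)
    have "f l w \<le> f i w" if l: "l \<in> I" for l
    proof (cases "l \<in> P")
      case True
      then have "\<tau> j * turn x y i k l \<le> \<tau> l * turn x y i k l"
        using j(2)[OF True] by (intro mult_right_mono) (auto simp: P_def)
      also have "\<dots> = f i top - f l top" using True by (simp add: \<tau>_def P_def)
      finally show ?thesis using diff[of l] by simp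
    next
      case False
      then have "turn x y i k l \<le> 0" using l by (simp add: P_def)
      then have "\<tau> j * turn x y i k l \<le> 0" using pos by (simp add: mult_le_0_iff)
      then show ?thesis using diff[of l] M_le[OF dd(1) l] by simp
    qed
    then have iw: "i \<in> M w" using dd(1) M_subset by (auto simp: M_def)
    have "f j w = f i w" using diff[of j] jP by (simp add: \<tau>_def)
    then have jw: "j \<in> M w" using M_memI[OF iw jP(1)] by simp
    have uw: "(i, k) \<in> up w" using in_up_below[OF td pos] iw by (simp add: w_def)
    have "w \<in> vertices"
      unfolding vertices_def using iw jw jP hull_edgesD(2)[OF uw[unfolded up_def]] by force
    then have wU: "w \<in> ?U" using Ev uw J[OF top(1) pos] w_def by auto
    \<comment> \<open>Below \<open>w\<close> function \<open>j\<close> overtakes, so the edge does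
      not continue there and \<open>w\<close> is new to the count.\<close>
    have "w \<notin> ?D" using downD(4)[of i k w j] jw jP by auto
    then have "card (insert w (?D - {top})) = card ?D"
      unfolding cD by (intro card_insert_disjoint finite_Diff finD) blast
    moreover have "card (insert w (?D - {top})) \<le> card ?U"
      using below_up wU by (intro card_mono finU) blast
    ultimately show ?thesis by simp
  qed
next
  case True
  show ?thesis unfolding True by simp
qed

lemma bottomless_inj_right:
  assumes "(i, k) \<in> bottomless" "(i', k) \<in> bottomless"
  shows "i = i'"
proof -
  obtain z z' where d: "(i, k) \<in> down z" and d': "(i', k) \<in> down z'"
    using assms by (auto simp: bottomless_def)
  note dd = downD[OF d] and dd' = downD[OF d']
  have I: "i \<in> I" "i' \<in> I" "k \<in> I" using dd dd' M_subset by blast+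
  have t0: "turn x y i k i' = 0" "turn x y i' k i = 0"
    using assms I turn_swap[of x y i' k i] by (force simp: bottomless_def)+
  have le: "f i' z \<le> f k z" "f i z' \<le> f k z'" using M_le dd(2) dd'(2) I by auto
  note eq = M_eq[OF dd(1,2)] M_eq[OF dd'(1,2)]
  \<comment> \<open>Collinear coefficients cancel the terms in \<open>w\<close>, so this combination
    is constant. At \<open>z\<close> and at \<open>z'\<close> one summand vanishes and the others
    have opposite signs, which forces both ties and puts the two edges on one line.\<close>
  have id: "(x i' - x k) * (f i w - f k w) - (x i - x k) * (f i' w - f k w)
      = (x i' - x k) * Re (c i - c k) - (x i - x k) * Re (c i' - c k)" for w
  proof -
    have "(x i' - x k) * (y i - y k) = (x i - x k) * (y i' - y k)"
      using t0(1) by (simp add: turn_def algebra_simps)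
    then have "(x i' - x k) * (y i - y k) * Im w = (x i - x k) * (y i' - y k) * Im w" by simp
    then show ?thesis by (simp add: f_def algebra_simps)
  qed
  have "(x i - x k) * (f i' z - f k z) = - ((x i' - x k) * (f i z' - f k z'))"
    using id[of z] id[of z'] eq by simp
  moreover have "(x i - x k) * (f i' z - f k z) \<le> 0" "(x i' - x k) * (f i z' - f k z') \<le> 0"
    using le dd(3) dd'(3) by (auto intro: mult_nonneg_nonpos)
  ultimately have "(x i - x k) * (f i' z - f k z) = 0" "(x i' - x k) * (f i z' - f k z') = 0"
    by linarith+
  then have "f i' z = f k z" "f i z' = f k z'" using dd(3) dd'(3) by auto
  then have "i' \<in> M z" "i \<in> M z'" using M_memI dd(2) dd'(2) I by auto
  then have "x i = x i'" using dd(5)[of i'] dd'(5)[of i] t0 by auto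
  then show ?thesis using inj_Re I by (auto dest: inj_onD)
qed

lemma bottomless_unbounded:
  assumes "(i, k) \<in> bottomless"
  shows "\<exists>w. k \<in> M w \<and> Im w < h"
proof -
  obtain z where d: "(i, k) \<in> down z" and all: "\<And>j. j \<in> I \<Longrightarrow> turn x y i k j \<le> 0"
    using assms by (auto simp: bottomless_def)
  note dd = downD[OF d]
  define t where "t = max 0 ((Im z - h + 1) / (x i - x k))"
  let ?w = "z - of_real t * dir i k"
  have diff: "f j ?w - f i ?w = f j z - f i z + t * turn x y i k j" for j
    using f_dir[of j z "-t" i k] by simp
  have "f j ?w \<le> f i ?w" if "j \<in> I" for j
  proof -
    have "t * turn x y i k j \<le> 0" using all[OF that] by (simp add: t_def mult_nonneg_nonpos)
    then show ?thesis using diff[of j] M_le[OF dd(1) that] by simp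
  qed
  moreover have "f k ?w = f i ?w" using diff[of k] M_eq[OF dd(1,2)] by (simp add: turn_right)
  ultimately have "k \<in> M ?w" using dd(2) M_subset by (auto simp: M_def)
  moreover have "t \<ge> (Im z - h + 1) / (x i - x k)" by (simp add: t_def)
  then have "t * (x i - x k) \<ge> Im z - h + 1" using dd(3) by (simp add: pos_divide_le_eq)
  then have "Im ?w < h" by (simp add: dir_def)
  ultimately show ?thesis by blast
qed

text \<open>Cells whose lowest point is \<open>z\<close>.\<close>

definition births :: "complex \<Rightarrow> 'i set" where
  "births z = {k. (\<exists>i. (i, k) \<in> up z) \<and> (\<exists>l\<in>M z. x l < x k)}"

text \<open>Relative to \<open>z\<close>, not being exceeded by \<open>i\<close> or \<open>l\<close>
  gives two half-planes; since \<open>turn x y i k l > 0\<close>, they meet in a cone opening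
  upwards with its tip as only lowest point.\<close>

lemma births_lowest:
  assumes "k \<in> births z" "k \<in> M z'"
  shows "z' = z \<or> Im z < Im z'"
proof -
  obtain i l where i: "(i, k) \<in> hull_edges x y (M z)" and l: "l \<in> M z" "x l < x k"
    using assms by (auto simp: births_def up_def)
  note id = hull_edgesD[OF i]
  define \<xi> \<delta> where "\<xi> = Re z' - Re z" and "\<delta> = Im z' - Im z"
  have D: "turn x y i k l > 0" using id(4,5)[OF l(1)] l(2) by force
  have I: "i \<in> I" "l \<in> I" using id l M_subset by blast+
  have 1: "(x i - x k) * \<xi> \<ge> (y i - y k) * \<delta>"
    using M_le[OF assms(2) I(1)] M_eq[OF id(1,2)] by (simp add: f_def \<xi>_def \<delta>_def algebra_simps)
  have 2: "(x k - x l) * \<xi> \<le> (y k - y l) * \<delta>"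
    using M_le[OF assms(2) I(2)] M_eq[OF l(1) id(2)] by (simp add: f_def \<xi>_def \<delta>_def algebra_simps)
  have "(x k - x l) * ((y i - y k) * \<delta>) \<le> (x k - x l) * ((x i - x k) * \<xi>)"
    using 1 l(2) by (intro mult_left_mono) auto
  also have "\<dots> = (x i - x k) * ((x k - x l) * \<xi>)" by simp
  also have "\<dots> \<le> (x i - x k) * ((y k - y l) * \<delta>)" using 2 id(3) by (intro mult_left_mono) auto
  finally have "turn x y i k l * \<delta> \<ge> 0" by (simp add: turn_def algebra_simps)
  then have \<delta>: "\<delta> \<ge> 0" using D by (simp add: zero_le_mult_iff)
  show ?thesis
  proof (cases "\<delta> = 0")
    case True
    then have "\<xi> \<ge> 0" "\<xi> \<le> 0" using 1 2 id(3) l(2) by (auto simp: zero_le_mult_iff mult_le_0_iff)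
    then show ?thesis using True by (simp add: \<xi>_def \<delta>_def complex_eq_iff)
  next
    case False
    then show ?thesis using \<delta> by (simp add: \<delta>_def)
  qed
qed

section \<open>The sweep count\<close>

text \<open>Summing the local inequality over the events and cancelling edges by
  \<open>edge_count\<close> bounds coincidences by bottomless edges plus births. Charging a
  bottomless edge to its right cell makes all charged cells distinct.\<close>

theorem card_coincidences_less:
  assumes I: "I \<noteq> {}" and Z: "finite Z"
    and two: "\<And>z. z \<in> Z \<Longrightarrow> card (M z) \<ge> 2"
    and eq: "\<And>z i j. z \<in> Z \<Longrightarrow> i \<in> M z \<Longrightarrow> j \<in> M z \<Longrightarrow> u i z = u j z"
  shows "card Z < card I"
proof -
  define Ev where "Ev = Z \<union> vertices"
  have Ev: "finite Ev" "vertices \<subseteq> Ev" using Z finite_vertices by (auto simp: Ev_def)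
  define s where "s z = card {(i, k) \<in> up z. u k z < u i z}" for z
  define w where "w z = card {(i, k) \<in> down z. u k z \<le> u i z}" for z
  have upI: "up z \<subseteq> I \<times> I" "down z \<subseteq> I \<times> I" for z
    using M_subset by (auto simp: up_def down_def hull_edges_def)
  have birthsI: "births z \<subseteq> I" for z using upI by (auto simp: births_def)
  have finP: "finite (I \<times> I)" using finite_I by simp
  have loc: "s z + of_bool (z \<in> Z) \<le> w z + card (births z)" for z
  proof -
    have "M z \<noteq> {}"
    proof -
      obtain i where "i \<in> I" "\<And>j. j \<in> I \<Longrightarrow> f j z \<le> f i z"
        using arg_min_if_finite[OF finite_I I, of "\<lambda>j. - f j z"]
        by (metis linorder_not_le neg_less_iff_less)
      then show ?thesis by (auto simp: M_def)
    qed
    then obtain l where l: "l \<in> M z" "\<And>j. j \<in> M z \<Longrightarrow> x l \<le> x j"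
      using arg_min_if_finite[OF finite_M, of z x] by (metis not_le)
    have "snd ` hull_edges x y (M z) - {l} = births z"
    proof (intro equalityI subsetI)
      fix k assume "k \<in> snd ` hull_edges x y (M z) - {l}"
      then obtain i where i: "(i, k) \<in> up z" "k \<noteq> l" by (auto simp: up_def)
      then have "k \<in> M z" by (auto simp: up_def hull_edges_def)
      then have "x l < x k" using l i inj_M[of z] by (metis inj_onD less_le)
      then show "k \<in> births z" using i l by (auto simp: births_def)
    next
      fix k assume "k \<in> births z"
      then obtain i l' where "(i, k) \<in> up z" "l' \<in> M z" "x l' < x k" by (auto simp: births_def)
      then show "k \<in> snd ` hull_edges x y (M z) - {l}"
        using l(2)[of l'] by (force simp: up_def)
    qed
    moreover have "card (M z) \<ge> 2 \<and> (\<forall>i\<in>M z. \<forall>j\<in>M z. u i z = u j z)"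
      if "of_bool (z \<in> Z) = (1::nat)"
    proof -
      have "z \<in> Z" using that by (cases "z \<in> Z") auto
      then show ?thesis using two eq by blast
    qed
    moreover have "\<forall>j\<in>M z. x l \<le> x j" "of_bool (z \<in> Z) \<le> (1::nat)" using l(2) by auto
    ultimately show ?thesis
      using hull_edges_local_count[OF finite_M inj_M l(1), of "of_bool (z \<in> Z)" "\<lambda>j. u j z" y]
      unfolding s_def w_def up_def down_def by argo
  qed
  have s_eq: "s z = card {e \<in> I \<times> I. e \<in> up z \<and> u (snd e) z < u (fst e) z}" for z
    unfolding s_def using upI by (intro arg_cong[where f = card]) auto
  have w_eq: "w z = card {e \<in> I \<times> I. e \<in> down z \<and> u (snd e) z \<le> u (fst e) z}" for z
    unfolding w_def using upI by (intro arg_cong[where f = card]) auto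
  have s_sum: "(\<Sum>z\<in>Ev. s z) = (\<Sum>e\<in>I \<times> I. card {z \<in> Ev. e \<in> up z \<and> u (snd e) z < u (fst e) z})"
    (is "_ = (\<Sum>e\<in>_. card (?A e))")
    unfolding s_eq by (rule sum_card_swap[OF Ev(1) finP])
  have w_sum: "(\<Sum>z\<in>Ev. w z) = (\<Sum>e\<in>I \<times> I. card {z \<in> Ev. e \<in> down z \<and> u (snd e) z \<le> u (fst e) z})"
    unfolding w_eq by (rule sum_card_swap[OF Ev(1) finP])
  have bl: "bottomless \<subseteq> I \<times> I" using upI by (auto simp: bottomless_def)
  have "(\<Sum>z\<in>Ev. w z) \<le> (\<Sum>e\<in>I \<times> I. card (?A e) + of_bool (e \<in> bottomless))"
    unfolding w_sum using edge_count[OF Ev, of "fst e" "snd e" for e] by (intro sum_mono) simp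
  also have "\<dots> = (\<Sum>z\<in>Ev. s z) + card bottomless"
    unfolding s_sum using bl finP
    by (simp add: sum.distrib sum_of_bool_eq Int_absorb1)
  finally have w_le: "(\<Sum>z\<in>Ev. w z) \<le> (\<Sum>z\<in>Ev. s z) + card bottomless" .
  have "(\<Sum>z\<in>Ev. s z + of_bool (z \<in> Z)) \<le> (\<Sum>z\<in>Ev. w z + card (births z))"
    by (intro sum_mono loc)
  moreover have "(\<Sum>z\<in>Ev. of_bool (z \<in> Z)) = card Z"
    using Ev(1) by (simp add: sum_of_bool_eq Ev_def Int_absorb1)
  moreover have "(\<Sum>z\<in>Ev. card (births z)) = card (\<Union>z\<in>Ev. births z)"
  proof (rule card_UN_disjoint[symmetric, OF Ev(1)])
    show "\<forall>z\<in>Ev. finite (births z)" using birthsI finite_I finite_subset by blast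
    have "z = z'" if "k \<in> births z" "k \<in> births z'" for k z z'
    proof -
      have "k \<in> M z" "k \<in> M z'" using that by (auto simp: births_def up_def hull_edges_def)
      then show ?thesis using births_lowest[OF that(1), of z'] births_lowest[OF that(2), of z] by auto
    qed
    then show "\<forall>z\<in>Ev. \<forall>z'\<in>Ev. z \<noteq> z' \<longrightarrow> births z \<inter> births z' = {}" by blast
  qed
  ultimately have main: "card Z \<le> card bottomless + card (\<Union>z\<in>Ev. births z)"
    using w_le by (simp add: sum.distrib)
  let ?B = "\<Union>z\<in>Ev. births z"
  have "inj_on snd bottomless" by (rule inj_onI) (auto dest: bottomless_inj_right)
  then have "card bottomless = card (snd ` bottomless)" by (simp add: card_image)
  moreover have "snd ` bottomless \<inter> ?B = {}"
  proof -
    have False if "(i, k) \<in> bottomless" "k \<in> births z" for i k z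
      using bottomless_unbounded[OF that(1), of "Im z"] births_lowest[OF that(2)] by force
    then show ?thesis by fastforce
  qed
  moreover have "finite (snd ` bottomless)" "finite ?B"
    using finite_subset[OF bl finP] Ev(1) finite_subset[OF birthsI finite_I] by auto
  ultimately have "card Z \<le> card (snd ` bottomless \<union> ?B)"
    using main by (simp add: card_Un_disjoint)
  also have "\<dots> < card I"
  proof (rule psubset_card_mono[OF finite_I])
    \<comment> \<open>The leftmost cell, that of the largest real part, is never on the right of an
      edge; omitting it gives strictness.\<close>
    obtain m where m: "m \<in> I" "\<And>j. j \<in> I \<Longrightarrow> x j \<le> x m"
      using arg_min_if_finite[OF finite_I I, of "\<lambda>j. - x j"]
      by (metis linorder_not_le neg_less_iff_less)
    have "m \<notin> snd ` bottomless"
    proof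
      assume "m \<in> snd ` bottomless"
      then obtain i z where i: "(i, m) \<in> down z" by (auto simp: bottomless_def)
      have "i \<in> I" "x m < x i" using downD(1,3)[OF i] M_subset by auto
      then show False using m(2) by force
    qed
    moreover have "m \<notin> births z" for z
    proof
      assume "m \<in> births z"
      then obtain i where i: "(i, m) \<in> hull_edges x y (M z)" by (auto simp: births_def up_def)
      have "i \<in> I" "x m < x i" using hull_edgesD(1,3)[OF i] M_subset by auto
      then show False using m(2) by force
    qed
    ultimately have "m \<notin> snd ` bottomless \<union> ?B" by blast
    moreover have "snd ` bottomless \<union> ?B \<subseteq> I" using bl birthsI by fastforce
    ultimately show "snd ` bottomless \<union> ?B \<subset> I" using m(1) by blast
  qed
  finally show ?thesis .
qed

end

section \<open>From slopes and intercepts to an envelope\<close>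

text \<open>The real part of \<open>Complex 1 r * d\<close> is \<open>Re d - r * Im d\<close>, so
  each \<open>d\<close> off the real axis rules out one \<open>r\<close>.\<close>

lemma ex_generic_multiplier:
  fixes D :: "complex set"
  assumes "finite D"
  shows "\<exists>w. w \<noteq> 0 \<and> (\<forall>d\<in>D. Re (w * d) = 0 \<longrightarrow> d = 0)"
proof -
  \<comment> \<open>If \<open>Im d = 0\<close>, the quotient is 0 by convention and merely excludes
    \<open>r = 0\<close>.\<close>
  have "finite ((\<lambda>d. Re d / Im d) ` D)" using assms by simp
  then obtain r where r: "r \<notin> (\<lambda>d. Re d / Im d) ` D"
    using ex_new_if_finite[OF infinite_UNIV_char_0] by blast
  have "d = 0" if "d \<in> D" "Re (Complex 1 r * d) = 0" for d
  proof -
    have e: "Re d = r * Im d" using that(2) by simp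
    have "Im d = 0"
    proof (rule ccontr)
      assume "Im d \<noteq> 0"
      then have "r = Re d / Im d" using e by simp
      then show False using r that(1) by blast
    qed
    then show ?thesis using e by (simp add: complex_eq_iff)
  qed
  moreover have "Complex 1 r \<noteq> 0" by (simp add: complex_eq_iff)
  ultimately show ?thesis by blast
qed

lemma card_slopes_less:
  fixes T :: "(complex \<times> complex) set" and Z :: "complex set"
  assumes T: "finite T" "T \<noteq> {}" and Z: "finite Z"
    and partner: "\<And>z b c. z \<in> Z \<Longrightarrow> (b, c) \<in> T \<Longrightarrow>
      \<exists>b' c'. (b', c') \<in> T \<and> b' \<noteq> b \<and> c' - z * b' = c - z * b"
  shows "card Z < card (fst ` T)"
proof -
  define I where "I = fst ` T"
  have I: "finite I" "I \<noteq> {}" using T by (auto simp: I_def)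
  \<comment> \<open>All values that occur; \<open>w\<close> will separate them by real part, making
    ties in real part genuine equalities.\<close>
  define V where "V = (\<lambda>(z, b, c). c - z * b) ` (Z \<times> T)"
  have "finite V" using T Z by (auto simp: V_def)
  then have "finite ((\<lambda>(v, v'). v - v') ` (V \<times> V))" by simp
  from ex_generic_multiplier[OF this] obtain w where w: "w \<noteq> 0"
    and w_inj: "\<And>v v'. v \<in> V \<Longrightarrow> v' \<in> V \<Longrightarrow> Re (w * (v - v')) = 0 \<Longrightarrow> v = v'"
    by fastforce
  \<comment> \<open>The factor \<open>\<omega>\<close> gives the coefficients distinct real parts;
    evaluating at \<open>z / \<omega>\<close> undoes it in the values.\<close>
  have "finite ((\<lambda>(b, b'). w * (b - b')) ` (I \<times> I))" using I by simp
  from ex_generic_multiplier[OF this] obtain \<omega> where \<omega>: "\<omega> \<noteq> 0"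
    and \<omega>_inj: "\<And>b b'. b \<in> I \<Longrightarrow> b' \<in> I \<Longrightarrow> Re (\<omega> * (w * (b - b'))) = 0 \<Longrightarrow> b = b'"
    using w by fastforce
  have "\<exists>c. (b, c) \<in> T \<and> (\<forall>c'. (b, c') \<in> T \<longrightarrow> Re (w * c') \<le> Re (w * c))" if "b \<in> I" for b
  proof -
    let ?C = "{c. (b, c) \<in> T}"
    have "finite ?C"
      by (rule finite_subset[of _ "snd ` T"]) (use T in force)+
    moreover have "?C \<noteq> {}" using that by (auto simp: I_def)
    ultimately show ?thesis
      using arg_min_if_finite[of ?C "\<lambda>c. - Re (w * c)"]
      by (metis (no_types, lifting) linorder_not_le mem_Collect_eq neg_less_iff_less)
  qed
  then obtain C where C: "\<And>b. b \<in> I \<Longrightarrow> (b, C b) \<in> T"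
    and C_max: "\<And>b c. b \<in> I \<Longrightarrow> (b, c) \<in> T \<Longrightarrow> Re (w * c) \<le> Re (w * C b)"
    by metis
  interpret envelope I "\<lambda>b. \<omega> * (w * b)" "\<lambda>b. w * C b"
  proof
    show "inj_on (\<lambda>b. Re (\<omega> * (w * b))) I"
    proof (rule inj_onI)
      fix b b' assume "b \<in> I" "b' \<in> I" "Re (\<omega> * (w * b)) = Re (\<omega> * (w * b'))"
      then show "b = b'" using \<omega>_inj[of b b'] by (simp add: algebra_simps)
    qed
  qed (rule I)
  have val: "w * C b - \<omega> * (w * b) * (z / \<omega>) = w * (C b - z * b)" for b z
    using \<omega> by (simp add: algebra_simps)
  have fv: "f b (z / \<omega>) = Re (w * (C b - z * b))" and uv: "u b (z / \<omega>) = Im (w * (C b - z * b))" for b z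
    unfolding f_def u_def val by (rule refl)+
  have "card ((\<lambda>z. z / \<omega>) ` Z) < card I"
  proof (rule card_coincidences_less)
    fix z' assume "z' \<in> (\<lambda>z. z / \<omega>) ` Z"
    then obtain z where z: "z \<in> Z" "z' = z / \<omega>" by blast
    have "Min ((\<lambda>b. - f b z') ` I) \<in> (\<lambda>b. - f b z') ` I" using I by (intro Min_in) auto
    then obtain b where b: "b \<in> I" "Min ((\<lambda>b. - f b z') ` I) = - f b z'" by blast
    have "f l z' \<le> f b z'" if "l \<in> I" for l
      using Min_le[of "(\<lambda>b. - f b z') ` I" "- f l z'"] b(2) that I by auto
    then have bM: "b \<in> M z'" using b(1) by (simp add: M_def)
    obtain b' c' where b': "(b', c') \<in> T" "b' \<noteq> b" "c' - z * b' = C b - z * b"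
      using partner[OF z(1) C[OF b(1)]] by blast
    have b'I: "b' \<in> I" using b'(1) by (force simp: I_def)
    \<comment> \<open>The partner's \<open>c'\<close> need not be the retained \<open>C b'\<close>,
      but replacing it can only raise the real part, which was already maximal.\<close>
    have "f b z' = Re (w * (c' - z * b'))" using fv[of b z] b'(3) z(2) by simp
    also have "\<dots> \<le> f b' z'"
      using C_max[OF b'I b'(1)] fv[of b' z] z(2) by (simp add: algebra_simps)
    finally have "b' \<in> M z'" using bM b'I M_le[OF bM b'I] by (intro M_memI[OF bM]) auto
    then have "{b, b'} \<subseteq> M z'" using bM by simp
    then show "2 \<le> card (M z')" using card_mono[OF finite_M[of z'], of "{b, b'}"] b'(2) by simp
  next
    fix z' i j assume "z' \<in> (\<lambda>z. z / \<omega>) ` Z" and ij: "i \<in> M z'" "j \<in> M z'"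
    then obtain z where z: "z \<in> Z" "z' = z / \<omega>" by blast
    have mem: "C k - z * k \<in> V" if "k \<in> M z'" for k
      using C[of k] that M_subset z(1) by (force simp: V_def)
    have "Re (w * ((C i - z * i) - (C j - z * j))) = 0"
      using M_eq[OF ij] fv[of i z] fv[of j z] z(2) by (simp add: algebra_simps)
    then have "C i - z * i = C j - z * j" using w_inj mem ij by blast
    then show "u i z' = u j z'" unfolding z(2) uv by (rule arg_cong)
  qed (use I Z in auto)
  moreover have "card ((\<lambda>z. z / \<omega>) ` Z) = card Z"
    using \<omega> by (intro card_image inj_onI) simp
  ultimately show ?thesis by (simp add: I_def)
qed

section \<open>Coordinates along and across the distinguished line\<close>

lemma complex_line_through:
  assumes "complex_line L" "p \<in> L"
  shows "\<exists>d. d \<noteq> 0 \<and> L = {p + t *s d | t. True}"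
proof -
  obtain a d where d: "d \<noteq> 0" "L = {a + t *s d | t. True}" using assms by (auto simp: complex_line_def)
  then obtain r where r: "p = a + r *s d" using assms by auto
  have "p + t *s d = a + (r + t) *s d" "a + t *s d = p + (t - r) *s d" for t
    by (auto simp: r vec_eq_iff algebra_simps)
  then have "L = {p + t *s d | t. True}" unfolding d(2) by blast
  then show ?thesis using d(1) by blast
qed

theorem theorem2:
  fixes S :: "(complex ^ 2) set" and l :: "nat \<Rightarrow> (complex ^ 2) set"
    and m :: nat and p :: "complex ^ 2"
  assumes "finite S"
    and "\<not> (\<exists>L. complex_line L \<and> S \<subseteq> L)"
    and "\<And>i. i \<in> {1..m} \<Longrightarrow> complex_line (l i)"
    and "inj_on l {1..m}"
    and "\<And>i. i \<in> {1..m} \<Longrightarrow> p \<in> l i"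
    and "S \<subseteq> (\<Union>i\<in>{1..m}. l i)"
    and "\<exists>j\<in>{1..m}. int (card ((S - {p}) \<inter> l j)) > int m - 2"
  shows "\<exists>L. ordinary_line S L"
proof (rule ccontr)
  assume none: "\<nexists>L. ordinary_line S L"
  obtain j where j: "j \<in> {1..m}" and jcard: "int (card ((S - {p}) \<inter> l j)) > int m - 2"
    using assms(7) by blast
  obtain d where d: "d \<noteq> 0" and lj: "l j = {p + t *s d | t. True}"
    using complex_line_through[OF assms(3,5)[OF j]] by blast
  \<comment> \<open>\<open>X\<close> is a determinant vanishing on \<open>l j\<close>,
    \<open>Y\<close> the Hermitian product with \<open>d\<close>; dividing by \<open>N\<close>, the
    squared norm of \<open>d\<close>, recovers the point.\<close>
  define X where "X v = (v $ 1 - p $ 1) * d $ 2 - (v $ 2 - p $ 2) * d $ 1" for v :: "complex ^ 2"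
  define Y where "Y v = (v $ 1 - p $ 1) * cnj (d $ 1) + (v $ 2 - p $ 2) * cnj (d $ 2)" for v :: "complex ^ 2"
  define N where "N = d $ 1 * cnj (d $ 1) + d $ 2 * cnj (d $ 2)"
  have N: "N \<noteq> 0"
  proof
    assume "N = 0"
    then have "complex_of_real ((cmod (d $ 1))\<^sup>2 + (cmod (d $ 2))\<^sup>2) = 0"
      by (simp only: N_def of_real_add complex_norm_square)
    then have "(cmod (d $ 1))\<^sup>2 + (cmod (d $ 2))\<^sup>2 = 0" by (simp only: of_real_eq_0_iff)
    then have "d $ 1 = 0" "d $ 2 = 0" by (simp_all add: sum_power2_eq_zero_iff)
    then show False using d by (simp add: vec_eq_iff forall_2)
  qed
  have inv1: "N * (v $ 1 - p $ 1) = Y v * d $ 1 + X v * cnj (d $ 2)"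
    and inv2: "N * (v $ 2 - p $ 2) = Y v * d $ 2 - X v * cnj (d $ 1)" for v
    unfolding X_def Y_def N_def by algebra+
  have X0: "v \<in> l j" if "X v = 0" for v
  proof -
    have "v $ 1 = p $ 1 + Y v / N * d $ 1" "v $ 2 = p $ 2 + Y v / N * d $ 2"
      using inv1[of v] inv2[of v] that N by (auto simp: field_simps)
    then have "v = p + (Y v / N) *s d" by (simp add: vec_eq_iff forall_2)
    then show ?thesis unfolding lj by blast
  qed
  have Xlj: "X v = 0" if "v \<in> l j" for v using that by (auto simp: lj X_def)
  have XY_inj: "v = v'" if "X v = X v'" "Y v = Y v'" for v v'
  proof -
    have "N * (v $ 1 - p $ 1) = N * (v' $ 1 - p $ 1)" "N * (v $ 2 - p $ 2) = N * (v' $ 2 - p $ 2)"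
      unfolding inv1 inv2 using that by simp_all
    then show ?thesis using N by (simp add: vec_eq_iff forall_2)
  qed
  have XYp: "X p = 0" "Y p = 0" by (simp_all add: X_def Y_def)
  define A where "A = (S - {p}) \<inter> l j"
  define Z where "Z = (\<lambda>a. 1 / Y a) ` A"
  define T where "T = (\<lambda>q. (Y q / X q, 1 / X q)) ` {q \<in> S. X q \<noteq> 0}"
  have YA: "Y a \<noteq> 0" if "a \<in> A" for a
    using that XY_inj[of a p] XYp Xlj by (auto simp: A_def)
  have "inj_on (\<lambda>a. 1 / Y a) A"
  proof (rule inj_onI)
    fix a a' assume a: "a \<in> A" "a' \<in> A" "1 / Y a = 1 / Y a'"
    then have "X a = X a'" "Y a = Y a'" using Xlj by (simp_all add: A_def)
    then show "a = a'" by (rule XY_inj)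
  qed
  then have cZ: "card Z = card A" by (simp add: Z_def card_image)
  have finT: "finite T" "finite Z" using assms(1) by (auto simp: T_def Z_def A_def)
  have "T \<noteq> {}" using X0 assms(2) assms(3)[OF j] by (auto simp: T_def)
  have "card Z < card (fst ` T)"
  proof (rule card_slopes_less[OF finT(1) \<open>T \<noteq> {}\<close> finT(2)])
    fix z b c assume "z \<in> Z" "(b, c) \<in> T"
    then obtain a q where a: "a \<in> A" "z = 1 / Y a"
      and q: "q \<in> S" "X q \<noteq> 0" "b = Y q / X q" "c = 1 / X q"
      by (auto simp: Z_def T_def)
    have aS: "a \<in> S" "X a = 0" using a(1) Xlj by (auto simp: A_def)
    have "q \<noteq> a" using q aS by auto
    define L where "L = {a + t *s (q - a) | t. True}"
    have L: "complex_line L" unfolding complex_line_def L_def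
      using \<open>q \<noteq> a\<close> by (intro exI[of _ a] exI[of _ "q - a"]) simp
    have "a + 0 *s (q - a) = a" "a + 1 *s (q - a) = q" by (simp_all add: vec_eq_iff)
    then have "a \<in> L" "q \<in> L" unfolding L_def by (metis (mono_tags, lifting) mem_Collect_eq)+
    then have sub: "{a, q} \<subseteq> S \<inter> L" using aS q by simp
    have "card (S \<inter> L) \<noteq> 2" using none L by (auto simp: ordinary_line_def)
    then have "S \<inter> L \<noteq> {a, q}" using \<open>q \<noteq> a\<close> by auto
    then obtain q' where q': "q' \<in> S" "q' \<in> L" "q' \<noteq> a" "q' \<noteq> q" using sub by blast
    then obtain t where t: "q' = a + t *s (q - a)" by (auto simp: L_def)
    have "t \<noteq> 0" "t \<noteq> 1" using q' t by (auto simp: vec_eq_iff)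
    have Xq': "X q' = t * X q"
    proof -
      have "X q' = X a + t * (X q - X a)" by (simp add: t X_def algebra_simps)
      then show ?thesis using aS by simp
    qed
    have Yq': "Y q' = Y a + t * (Y q - Y a)" by (simp add: t Y_def algebra_simps)
    have "X q' \<noteq> 0" using Xq' q(2) \<open>t \<noteq> 0\<close> by simp
    \<comment> \<open>Equal slopes would put \<open>q\<close> and \<open>q'\<close> on one line
      through \<open>p\<close>; that line would be \<open>L\<close> and meet \<open>l j\<close> only
      at \<open>p\<close>, whereas \<open>a\<close> differs from \<open>p\<close>.\<close>
    have "Y q' / X q' \<noteq> b"
    proof
      assume "Y q' / X q' = b"
      then have "Y a + t * (Y q - Y a) = t * Y q"
        using q(2,3) \<open>t \<noteq> 0\<close> Xq' Yq' by (simp add: field_simps)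
      then have "(1 - t) * Y a = 0" by (simp add: algebra_simps)
      then show False using YA[OF a(1)] \<open>t \<noteq> 1\<close> by simp
    qed
    moreover have "1 / X q' - z * (Y q' / X q') = c - z * b"
      unfolding Xq' Yq' a(2) q(3,4) using YA[OF a(1)] q(2) \<open>t \<noteq> 0\<close> by (simp add: field_simps)
    moreover have "(Y q' / X q', 1 / X q') \<in> T" using q'(1) \<open>X q' \<noteq> 0\<close> by (auto simp: T_def)
    ultimately show "\<exists>b' c'. (b', c') \<in> T \<and> b' \<noteq> b \<and> c' - z * b' = c - z * b" by blast
  qed
  \<comment> \<open>\<open>Y / X\<close> is constant on each line through \<open>p\<close> where
    defined, and \<open>l j\<close> contributes no slope, so at most \<open>m - 1\<close> values
    remain.\<close>
  moreover have "card (fst ` T) \<le> m - 1"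
  proof -
    have "\<exists>r. \<forall>q\<in>l i. X q \<noteq> 0 \<longrightarrow> Y q / X q = r" if i: "i \<in> {1..m}" for i
    proof -
      obtain e where e: "l i = {p + t *s e | t. True}"
        using complex_line_through[OF assms(3,5)[OF i]] by blast
      have "Y q / X q = Y (p + e) / X (p + e)" if q: "q \<in> l i" "X q \<noteq> 0" for q
      proof -
        obtain t where "q = p + t *s e" using q(1) e by blast
        then have "X q = t * X (p + e)" "Y q = t * Y (p + e)" by (simp_all add: X_def Y_def algebra_simps)
        then show ?thesis using q(2) by auto
      qed
      then show ?thesis by blast
    qed
    then obtain r where r: "\<And>i q. i \<in> {1..m} \<Longrightarrow> q \<in> l i \<Longrightarrow> X q \<noteq> 0 \<Longrightarrow> Y q / X q = r i"
      by metis
    have "fst ` T \<subseteq> r ` ({1..m} - {j})"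
    proof
      fix b assume "b \<in> fst ` T"
      then obtain q where q: "q \<in> S" "X q \<noteq> 0" "b = Y q / X q" by (auto simp: T_def)
      then obtain i where i: "i \<in> {1..m}" "q \<in> l i" using assms(6) by blast
      then have "i \<noteq> j" using q Xlj by blast
      then show "b \<in> r ` ({1..m} - {j})" using r[OF i q(2)] q(3) i(1) by blast
    qed
    then have "card (fst ` T) \<le> card ({1..m} - {j})"
      by (intro surj_card_le) auto
    then show ?thesis using j by simp
  qed
  \<comment> \<open>At most \<open>m - 2\<close> points on \<open>l j\<close> apart from
    \<open>p\<close>, exactly what \<open>jcard\<close> excludes.\<close>
  ultimately have "card A < m - 1" using cZ by linarith
  then show False using jcard j unfolding A_def by simp
qed

end
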